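(* Let $I\subset\mathbb{R}$ be an interval, let $p\in\mathbb{N}$, $p>1$, and let $M_1,\dots,M_p\colon I^p\to I$ be means. Assume that $K\colon I^p\to I$ is a continuous and monotone mean which is invariant with respect to the mean-type mapping $\mathbf{M}:=(M_1,\dots,M_p)\colon I^p\to I^p$, that is, $K\circ\mathbf{M}=K$. Then for every nonempty subset $S\subseteq\{1,\dots,p\}$ there exists a unique mean $K_S(\mathbf{M})\colon I^p\to I$ such that $K\circ \mathbf{K}_S(\mathbf{M})=K$, where $\mathbf{K}_S(\mathbf{M})\colon I^p\to I^p$ is the mapping whose $i$-th coordinate is $$[\mathbf{K}_S(\mathbf{M})]_i:=\begin{cases}K_S(\mathbf{M}) & \text{for } i\in S,\\ M_i & \text{for } i\in\{1,\dots,p\}\setminus S.\end{cases}$$ Moreover, $\min(M_i\colon i\in S)\le K_S(\mathbf{M})\le\max(M_i\colon i\in S)$ pointwise on $I^p$.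
   Context: A function $M\colon I^p\to I$ is a mean if $\min(x_1,\dots,x_p)\le M(x_1,\dots,x_p)\le\max(x_1,\dots,x_p)$ for all $x_1,\dots,x_p\in I$. A mean is monotone if it is strictly increasing in each of its variables. No continuity or monotonicity of the means $M_i$ is assumed. *)

theory Defs
  imports "HOL-Analysis.Analysis"
begin

text \<open>The cube \<open>I\<^sup>p\<close>, where \<open>p = CARD('n)\<close> and the coordinates are indexed by \<open>'n\<close>.\<close>

definition cube :: "real set \<Rightarrow> (real ^ 'n) set" where
  "cube I = {x. \<forall>i. x $ i \<in> I}"

text \<open>
  Only the values of \<open>M\<close> on \<open>cube I\<close> matter here, so two distinct HOL functions may
  represent the same mean. To speak about uniqueness, restrict to \<open>extensional (cube I)\<close>.
\<close>

definition is_mean :: "real set \<Rightarrow> (real ^ 'n \<Rightarrow> real) \<Rightarrow> bool" where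
  "is_mean I M \<longleftrightarrow> M \<in> cube I \<rightarrow> I \<and>
     (\<forall>x\<in>cube I. Min (range (\<lambda>i. x $ i)) \<le> M x \<and> M x \<le> Max (range (\<lambda>i. x $ i)))"

definition strictly_increasing_in_each :: "real set \<Rightarrow> (real ^ 'n \<Rightarrow> real) \<Rightarrow> bool" where
  "strictly_increasing_in_each I K \<longleftrightarrow>
     (\<forall>x\<in>cube I. \<forall>i. strict_mono_on I (\<lambda>t. K (\<chi> j. if j = i then t else x $ j)))"

definition monotone_mean :: "real set \<Rightarrow> (real ^ 'n \<Rightarrow> real) \<Rightarrow> bool" where
  "monotone_mean I K \<longleftrightarrow> is_mean I K \<and> strictly_increasing_in_each I K"

definition mean_type_mapping :: "('n \<Rightarrow> real ^ 'n \<Rightarrow> real) \<Rightarrow> real ^ 'n \<Rightarrow> real ^ 'n" where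
  "mean_type_mapping M x = (\<chi> i. M i x)"

definition invariant_wrt ::
    "real set \<Rightarrow> (real ^ 'n \<Rightarrow> real) \<Rightarrow> (real ^ 'n \<Rightarrow> real ^ 'n) \<Rightarrow> bool" where
  "invariant_wrt I K F \<longleftrightarrow> (\<forall>x\<in>cube I. K (F x) = K x)"

definition replace_on ::
    "'n set \<Rightarrow> (real ^ 'n \<Rightarrow> real) \<Rightarrow> ('n \<Rightarrow> real ^ 'n \<Rightarrow> real) \<Rightarrow> 'n \<Rightarrow> real ^ 'n \<Rightarrow> real" where
  "replace_on S N M = (\<lambda>i. if i \<in> S then N else M i)"

end

theory Submission
  imports Defs
begin

text \<open>
  Uniqueness, existence and the sharp bounds all come from a pointwise statement about a single
  scalar equation. Fix \<open>x\<close> in the cube and put \<open>y = (M\<^sub>1 x, \<dots>, M\<^sub>p x)\<close>. The invariance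
  required of a mean \<open>N\<close> says exactly that the number \<open>t = N x\<close> solves \<open>\<phi> t = K x\<close>, where
  \<open>\<phi> t\<close> is the value of \<open>K\<close> at \<open>y\<close> with every coordinate in \<open>S\<close> overwritten by the same
  number \<open>t\<close>. Since \<open>K\<close> increases strictly in each variable, it increases strictly in the
  coordinatewise order, so \<open>\<phi>\<close> is strictly increasing and there is at most one solution. The
  given invariance \<open>K y = K x\<close> locates it: overwriting with the least of the numbers
  \<open>M\<^sub>i x\<close>, \<open>i \<in> S\<close>, only lowers \<open>y\<close>, and overwriting with the greatest only raises it, so
  \<open>K x\<close> lies between the values of \<open>\<phi>\<close> at these two numbers. By the intermediate value
  theorem a solution exists between them, and since each \<open>M\<^sub>i\<close> is a mean, so is the function
  that selects the solution for each \<open>x\<close>.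
\<close>

definition overwrite :: "'n set \<Rightarrow> real \<Rightarrow> real ^ 'n \<Rightarrow> real ^ 'n" where
  "overwrite S t y = (\<chi> i. if i \<in> S then t else y $ i)"

lemma overwrite_nth [simp]: "overwrite S t y $ i = (if i \<in> S then t else y $ i)"
  by (simp add: overwrite_def)

lemma overwrite_in_cube: "y \<in> cube I \<Longrightarrow> t \<in> I \<Longrightarrow> overwrite S t y \<in> cube I"
  by (simp add: cube_def)

lemma mean_type_mapping_replace_on:
  "mean_type_mapping (replace_on S N M) x = overwrite S (N x) (mean_type_mapping M x)"
  by (simp add: vec_eq_iff mean_type_mapping_def replace_on_def)

lemma mean_type_mapping_in_cube:
  assumes "\<And>i. is_mean I (M i)" and "x \<in> cube I"
  shows "mean_type_mapping M x \<in> cube I"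
  using assms by (auto simp: mean_type_mapping_def cube_def is_mean_def)

text \<open>
  One passes from \<open>x\<close> to \<open>y\<close> by changing the coordinates one at a time, and no change lowers
  the value of \<open>K\<close>.
\<close>

lemma mono_of_strictly_increasing_in_each:
  fixes K :: "real ^ 'n \<Rightarrow> real"
  assumes inc: "strictly_increasing_in_each I K"
    and x: "x \<in> cube I" and y: "y \<in> cube I" and le: "\<And>i. x $ i \<le> y $ i"
  shows "K x \<le> K y"
proof -
  have "K x \<le> K (\<chi> i. if i \<in> A then y $ i else x $ i)" for A :: "'n set"
  proof (induction rule: finite_induct [OF finite [of A]])
    case 1
    show ?case by simp
  next
    case (2 a A)
    let ?z = "\<chi> i. if i \<in> A then y $ i else x $ i"
    have "?z \<in> cube I"
      using x y by (simp add: cube_def)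
    then have "strict_mono_on I (\<lambda>t. K (\<chi> j. if j = a then t else ?z $ j))"
      using inc unfolding strictly_increasing_in_each_def by blast
    then have "mono_on I (\<lambda>t. K (\<chi> j. if j = a then t else ?z $ j))"
      by (rule strict_mono_on_imp_mono_on)
    moreover have "x $ a \<in> I" "y $ a \<in> I"
      using x y by (simp_all add: cube_def)
    ultimately have "K (\<chi> j. if j = a then x $ a else ?z $ j)
        \<le> K (\<chi> j. if j = a then y $ a else ?z $ j)"
      using le by (rule mono_onD)
    moreover have "(\<chi> j. if j = a then x $ a else ?z $ j) = ?z"
      using \<open>a \<notin> A\<close> by (simp add: vec_eq_iff)
    moreover have "(\<chi> j. if j = a then y $ a else ?z $ j)
        = (\<chi> i. if i \<in> insert a A then y $ i else x $ i)"
      by (simp add: vec_eq_iff)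
    ultimately show ?case
      using 2 by simp
  qed
  from this [of UNIV] show ?thesis by simp
qed

text \<open>
  Raising a strictly smaller coordinate first already gives a strict increase; the remaining
  coordinates cannot undo it.
\<close>

lemma strict_mono_of_strictly_increasing_in_each:
  fixes K :: "real ^ 'n \<Rightarrow> real"
  assumes inc: "strictly_increasing_in_each I K"
    and x: "x \<in> cube I" and y: "y \<in> cube I" and le: "\<And>i. x $ i \<le> y $ i"
    and less: "x $ a < y $ a"
  shows "K x < K y"
proof -
  let ?z = "\<chi> j. if j = a then y $ a else x $ j"
  have "strict_mono_on I (\<lambda>t. K (\<chi> j. if j = a then t else x $ j))"
    using inc x unfolding strictly_increasing_in_each_def by blast
  moreover have "x $ a \<in> I" "y $ a \<in> I"
    using x y by (simp_all add: cube_def)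
  ultimately have "K (\<chi> j. if j = a then x $ a else x $ j) < K ?z"
    using less by (rule strict_mono_onD)
  moreover have "(\<chi> j. if j = a then x $ a else x $ j) = x"
    by (simp add: vec_eq_iff)
  moreover have "K ?z \<le> K y"
    using x y le by (intro mono_of_strictly_increasing_in_each [OF inc]) (auto simp: cube_def)
  ultimately show ?thesis by simp
qed

lemma strict_mono_on_overwrite:
  fixes K :: "real ^ 'n \<Rightarrow> real"
  assumes inc: "strictly_increasing_in_each I K" and y: "y \<in> cube I" and "S \<noteq> {}"
  shows "strict_mono_on I (\<lambda>t. K (overwrite S t y))"
proof (rule strict_mono_onI)
  fix s t assume st: "s \<in> I" "t \<in> I" "s < t"
  obtain a where "a \<in> S" using \<open>S \<noteq> {}\<close> by blast
  then show "K (overwrite S s y) < K (overwrite S t y)"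
    using st y
    by (intro strict_mono_of_strictly_increasing_in_each [OF inc, where a = a])
      (auto intro: overwrite_in_cube)
qed

lemma continuous_on_overwrite:
  fixes K :: "real ^ 'n \<Rightarrow> real"
  assumes K: "continuous_on (cube I) K" and y: "y \<in> cube I"
  shows "continuous_on I (\<lambda>t. K (overwrite S t y))"
proof (rule continuous_on_compose2 [OF K])
  have "continuous_on I (\<lambda>t. if i \<in> S then t else y $ i)" for i
    by (cases "i \<in> S") simp_all
  then show "continuous_on I (\<lambda>t. overwrite S t y)"
    unfolding overwrite_def by (rule continuous_on_vec_lambda)
  show "(\<lambda>t. overwrite S t y) ` I \<subseteq> cube I"
    using y by (auto intro: overwrite_in_cube)
qed

text \<open>
  The intermediate value theorem for \<open>t \<mapsto> K (overwrite S t y)\<close>: overwriting by the least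
  selected coordinate gives a point below \<open>y\<close>, by the greatest a point above \<open>y\<close>.
\<close>

lemma overwrite_level_exists:
  fixes K :: "real ^ 'n \<Rightarrow> real"
  assumes I: "is_interval I" and cont: "continuous_on (cube I) K"
    and inc: "strictly_increasing_in_each I K" and y: "y \<in> cube I" and "S \<noteq> {}"
  shows "\<exists>t\<in>I. Min (($) y ` S) \<le> t \<and> t \<le> Max (($) y ` S) \<and> K (overwrite S t y) = K y"
proof -
  let ?lo = "Min (($) y ` S)" and ?hi = "Max (($) y ` S)"
  have nonempty: "finite (($) y ` S)" "($) y ` S \<noteq> {}"
    using \<open>S \<noteq> {}\<close> by auto
  have sub: "($) y ` S \<subseteq> I"
    using y by (auto simp: cube_def)
  have lo: "?lo \<in> I" and hi: "?hi \<in> I"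
    using sub Min_in [OF nonempty] Max_in [OF nonempty] by blast+
  have "K (overwrite S ?lo y) \<le> K y"
    using lo y
    by (intro mono_of_strictly_increasing_in_each [OF inc]) (auto intro: overwrite_in_cube)
  moreover have "K y \<le> K (overwrite S ?hi y)"
    using hi y
    by (intro mono_of_strictly_increasing_in_each [OF inc]) (auto intro: overwrite_in_cube)
  moreover have "?lo \<le> ?hi"
    using nonempty Min_in Max_ge by blast
  moreover have between: "{?lo..?hi} \<subseteq> I"
    using mem_is_interval_1_I [OF I lo hi] by auto
  then have "continuous_on {?lo..?hi} (\<lambda>t. K (overwrite S t y))"
    using continuous_on_overwrite [OF cont y] continuous_on_subset by blast
  ultimately obtain t where "?lo \<le> t" "t \<le> ?hi" "K (overwrite S t y) = K y"
    using IVT' [of "\<lambda>t. K (overwrite S t y)" ?lo "K y" ?hi] by blast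
  then show ?thesis
    using between by auto
qed

theorem theorem2:
  fixes I :: "real set"
    and M :: "'n::finite \<Rightarrow> real ^ 'n \<Rightarrow> real"
    and K :: "real ^ 'n \<Rightarrow> real"
    and S :: "'n set"
  assumes "is_interval I"
    and "CARD('n) > 1"
    and "\<And>i. is_mean I (M i)"
    and "continuous_on (cube I) K"
    and "monotone_mean I K"
    and "invariant_wrt I K (mean_type_mapping M)"
    and "S \<noteq> {}"
  shows "(\<exists>!N. N \<in> extensional (cube I) \<and> is_mean I N \<and>
              invariant_wrt I K (mean_type_mapping (replace_on S N M))) \<and>
         (\<forall>N. is_mean I N \<and> invariant_wrt I K (mean_type_mapping (replace_on S N M)) \<longrightarrow>
              (\<forall>x\<in>cube I. Min ((\<lambda>i. M i x) ` S) \<le> N x \<and> N x \<le> Max ((\<lambda>i. M i x) ` S)))"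
proof -
  let ?y = "mean_type_mapping M"
  let ?sol = "\<lambda>x t. t \<in> I \<and> K (overwrite S t (?y x)) = K x"
  let ?within = "\<lambda>x t. Min ((\<lambda>i. M i x) ` S) \<le> t \<and> t \<le> Max ((\<lambda>i. M i x) ` S)"
  have inc: "strictly_increasing_in_each I K"
    using assms(5) by (simp add: monotone_mean_def)
  have y: "?y x \<in> cube I" if "x \<in> cube I" for x
    using mean_type_mapping_in_cube [of I M x] assms(3) that by blast
  have ex: "\<exists>t. ?sol x t \<and> ?within x t" if "x \<in> cube I" for x
  proof -
    have "($) (?y x) = (\<lambda>i. M i x)"
      by (simp add: fun_eq_iff mean_type_mapping_def)
    moreover have "K (?y x) = K x"
      using assms(6) that by (simp add: invariant_wrt_def)
    ultimately show ?thesis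
      using overwrite_level_exists [OF assms(1,4) inc y [OF that] assms(7)] by auto
  qed
  have uniq: "s = t" if "x \<in> cube I" "?sol x s" "?sol x t" for x s t
    using strict_mono_on_imp_inj_on [OF strict_mono_on_overwrite [OF inc y [OF that(1)] assms(7)]]
      that(2,3) by (simp add: inj_on_def)
  have within: "?within x t" if "x \<in> cube I" "?sol x t" for x t
    using ex [OF that(1)] uniq [OF that(1)] that(2) by blast
  have sol_mean: "?sol x (N x)"
    if "is_mean I N" "invariant_wrt I K (mean_type_mapping (replace_on S N M))" "x \<in> cube I"
    for N x
    using that by (auto simp: is_mean_def invariant_wrt_def mean_type_mapping_replace_on)

  define N where "N = restrict (\<lambda>x. SOME t. ?sol x t) (cube I)"
  have sol: "?sol x (N x)" if "x \<in> cube I" for x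
    using someI_ex [of "?sol x"] ex [OF that] that by (auto simp: N_def)
  have mean: "is_mean I N"
    unfolding is_mean_def
  proof (intro conjI ballI Pi_I)
    fix x :: "real ^ 'n" assume x: "x \<in> cube I"
    show "N x \<in> I" using sol [OF x] by simp
    have M: "Min (range (\<lambda>i. x $ i)) \<le> M i x" "M i x \<le> Max (range (\<lambda>i. x $ i))" for i
      using assms(3) x by (auto simp: is_mean_def)
    have "Min (range (\<lambda>i. x $ i)) \<le> Min ((\<lambda>i. M i x) ` S)"
      using M(1) assms(7) by (subst Min_ge_iff) auto
    then show "Min (range (\<lambda>i. x $ i)) \<le> N x"
      using within [OF x sol [OF x]] by linarith
    have "Max ((\<lambda>i. M i x) ` S) \<le> Max (range (\<lambda>i. x $ i))"
      using M(2) assms(7) by (subst Max_le_iff) auto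
    then show "N x \<le> Max (range (\<lambda>i. x $ i))"
      using within [OF x sol [OF x]] by linarith
  qed
  have inv: "invariant_wrt I K (mean_type_mapping (replace_on S N M))"
    using sol by (simp add: invariant_wrt_def mean_type_mapping_replace_on)
  have ext: "N \<in> extensional (cube I)"
    by (simp add: N_def)
  have unique: "N' = N"
    if "N' \<in> extensional (cube I)" "is_mean I N'"
      "invariant_wrt I K (mean_type_mapping (replace_on S N' M))" for N'
  proof (rule extensionalityI [OF that(1) ext])
    fix x :: "real ^ 'n" assume "x \<in> cube I"
    then show "N' x = N x"
      using sol_mean [OF that(2,3)] sol by (intro uniq)
  qed
  have "\<exists>!N. N \<in> extensional (cube I) \<and> is_mean I N \<and>
      invariant_wrt I K (mean_type_mapping (replace_on S N M))"
    by (intro ex1I [of _ N] conjI ext mean inv) (elim conjE, rule unique)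
  moreover have "?within x (N x)"
    if "is_mean I N" "invariant_wrt I K (mean_type_mapping (replace_on S N M))" "x \<in> cube I"
    for N x
    using that(3) sol_mean [OF that] by (rule within)
  ultimately show ?thesis by blast
qed

end
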